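(* Let $T>0$. Then $\overline{\mathcal R_T(0)}=\mathcal H$, where the closure is taken in $\widehat H^0(\mathbb R^2)$.
   Context: $\mathbb R_+=(0,+\infty)$; function spaces (including the controls $L^\infty(0,T)$) are complex. $\widehat H^0(\mathbb R^2)$ is the subspace of $L^2(\mathbb R^2)$ (with the $L^2$ norm) of functions even with respect to $x_1$. $\mathcal H=\{f\in L^2(\mathbb R^2): \exists g\in L^2(\mathbb R_+),\ f(x)=g(|x|^2)\text{ a.e. on }\mathbb R^2\}$. $\mathcal R_T(0)$ is the set of all functions of the form $$\mathcal W_u(x,T)=-\frac1\pi\int_0^T\frac1{2\xi}e^{-\frac{|x|^2}{4\xi}}u(T-\xi)\,d\xi,\quad u\in L^\infty(0,T),$$ i.e. the set of states at time $T$ reachable from the zero initial state for the control system $W_t=\Delta W-2\delta u(t)$ on $\mathbb R^2$. *)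

theory Defs
  imports "HOL-Analysis.Analysis"
begin

section \<open>The spaces $L^2$ and $L^\infty$\<close>

text \<open>
  Elements of the Lebesgue spaces are represented by functions; almost everywhere equal
  functions are not identified.  Accordingly the \<open>L\<^sup>2\<close> norm is only a seminorm and
  \<open>L2_topology\<close> is the (non-Hausdorff) topology of its pseudometric, whose
  Kolmogorov quotient is the usual Hilbert space topology on equivalence classes.
  A closure in it contains with a function all its a.e. equal modifications.
\<close>

definition L2 :: "'a measure \<Rightarrow> ('a \<Rightarrow> complex) set" where
  "L2 M = {f \<in> borel_measurable M. integrable M (\<lambda>x. (cmod (f x))\<^sup>2)}"

definition L2_norm :: "'a measure \<Rightarrow> ('a \<Rightarrow> complex) \<Rightarrow> real" where
  "L2_norm M f = sqrt (LINT x|M. (cmod (f x))\<^sup>2)"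

definition L2_topology :: "'a measure \<Rightarrow> ('a \<Rightarrow> complex) topology" where
  "L2_topology M = topology (\<lambda>U. U \<subseteq> L2 M \<and>
     (\<forall>f\<in>U. \<exists>e>0. \<forall>g\<in>L2 M. L2_norm M (\<lambda>x. f x - g x) < e \<longrightarrow> g \<in> U))"

definition Linf :: "'a measure \<Rightarrow> ('a \<Rightarrow> complex) set" where
  "Linf M = {u \<in> borel_measurable M. \<exists>C. AE x in M. cmod (u x) \<le> C}"

lemma openin_L2_topology:
  "openin (L2_topology M) U \<longleftrightarrow> U \<subseteq> L2 M \<and>
     (\<forall>f\<in>U. \<exists>e>0. \<forall>g\<in>L2 M. L2_norm M (\<lambda>x. f x - g x) < e \<longrightarrow> g \<in> U)"
proof -
  define P where "P = (\<lambda>U. U \<subseteq> L2 M \<and>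
     (\<forall>f\<in>U. \<exists>e>0. \<forall>g\<in>L2 M. L2_norm M (\<lambda>x. f x - g x) < e \<longrightarrow> g \<in> U))"
  have "istopology P"
    unfolding istopology_def
  proof (intro conjI allI impI)
    fix S T assume S: "P S" and T: "P T"
    show "P (S \<inter> T)"
      unfolding P_def
    proof (intro conjI ballI)
      show "S \<inter> T \<subseteq> L2 M" using S by (auto simp: P_def)
      fix f assume f: "f \<in> S \<inter> T"
      obtain d e where "d > 0" "\<forall>g\<in>L2 M. L2_norm M (\<lambda>x. f x - g x) < d \<longrightarrow> g \<in> S"
        "e > 0" "\<forall>g\<in>L2 M. L2_norm M (\<lambda>x. f x - g x) < e \<longrightarrow> g \<in> T"
        using S T f unfolding P_def by blast
      then show "\<exists>e>0. \<forall>g\<in>L2 M. L2_norm M (\<lambda>x. f x - g x) < e \<longrightarrow> g \<in> S \<inter> T"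
        by (intro exI[of _ "min d e"]) auto
    qed
  next
    fix K assume "\<forall>S\<in>K. P S"
    then show "P (\<Union>K)" unfolding P_def by (meson Sup_le_iff Union_iff)
  qed
  then show ?thesis
    unfolding L2_topology_def P_def by (simp add: topology_inverse')
qed

lemma topspace_L2_topology [simp]: "topspace (L2_topology M) = L2 M"
proof
  show "topspace (L2_topology M) \<subseteq> L2 M"
    by (meson openin_L2_topology openin_topspace)
  have "openin (L2_topology M) (L2 M)"
    unfolding openin_L2_topology by (auto intro: exI[of _ 1])
  then show "L2 M \<subseteq> topspace (L2_topology M)" by (rule openin_subset)
qed

lemma L2_add_norm_less:
  assumes f: "f \<in> L2 M" and g: "g \<in> L2 M"
    and r: "L2_norm M f < r" and s: "L2_norm M g < s"
  shows "(\<lambda>x. f x + g x) \<in> L2 M \<and> L2_norm M (\<lambda>x. f x + g x) < r + s"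
proof -
  have [measurable]: "f \<in> borel_measurable M" "g \<in> borel_measurable M"
    using f g by (auto simp: L2_def)
  have If: "integrable M (\<lambda>x. (cmod (f x))\<^sup>2)" and Ig: "integrable M (\<lambda>x. (cmod (g x))\<^sup>2)"
    using f g by (auto simp: L2_def)
  define F where "F = (LINT x|M. (cmod (f x))\<^sup>2)"
  define G where "G = (LINT x|M. (cmod (g x))\<^sup>2)"
  have "F \<ge> 0" "G \<ge> 0" by (simp_all add: F_def G_def)
  have sF: "sqrt F < r" and sG: "sqrt G < s"
    using r s by (auto simp: L2_norm_def F_def G_def)
  have pos: "r > 0" "s > 0"
    using sF sG \<open>F \<ge> 0\<close> \<open>G \<ge> 0\<close> by (meson le_less_trans real_sqrt_ge_zero)+
  have F: "F < r\<^sup>2" and G: "G < s\<^sup>2"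
    using sF sG pos by (simp_all add: real_less_rsqrt real_sqrt_less_iff
        flip: real_sqrt_less_iff[of _ "_\<^sup>2"])
  define t where "t = s / r"
  have t: "t > 0" using pos by (simp add: t_def)
  have bound: "(cmod (f x + g x))\<^sup>2 \<le> (1 + t) * (cmod (f x))\<^sup>2 + (1 + 1/t) * (cmod (g x))\<^sup>2" for x
  proof -
    define a b where "a = cmod (f x)" and "b = cmod (g x)"
    have "(cmod (f x + g x))\<^sup>2 \<le> (a + b)\<^sup>2"
      unfolding a_def b_def by (intro power_mono norm_triangle_ineq) auto
    moreover have "(1 + t) * a\<^sup>2 + (1 + 1/t) * b\<^sup>2 - (a + b)\<^sup>2 = (t * a - b)\<^sup>2 / t"
      using t by (simp add: field_simps power2_eq_square)
    moreover have "(t * a - b)\<^sup>2 / t \<ge> 0" using t by simp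
    ultimately have "(cmod (f x + g x))\<^sup>2 \<le> (1 + t) * a\<^sup>2 + (1 + 1/t) * b\<^sup>2" by linarith
    then show ?thesis by (simp only: a_def b_def)
  qed
  have Ib: "integrable M (\<lambda>x. (1 + t) * (cmod (f x))\<^sup>2 + (1 + 1/t) * (cmod (g x))\<^sup>2)"
    using If Ig by simp
  have I: "integrable M (\<lambda>x. (cmod (f x + g x))\<^sup>2)"
  proof (rule Bochner_Integration.integrable_bound[OF Ib])
    show "AE x in M. norm ((cmod (f x + g x))\<^sup>2)
        \<le> norm ((1 + t) * (cmod (f x))\<^sup>2 + (1 + 1/t) * (cmod (g x))\<^sup>2)"
      using order_trans[OF bound abs_ge_self] by (intro AE_I2) simp
  qed simp
  have "(LINT x|M. (cmod (f x + g x))\<^sup>2) \<le> (1 + t) * F + (1 + 1/t) * G"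
    using integral_mono[OF I Ib] bound If Ig by (simp add: F_def G_def)
  also have "\<dots> < (1 + t) * r\<^sup>2 + (1 + 1/t) * s\<^sup>2"
    using F G t by (intro add_strict_mono mult_strict_left_mono) (auto simp: add_pos_pos)
  also have "\<dots> = (r + s)\<^sup>2"
    using pos by (simp add: t_def field_simps power2_eq_square)
  finally have "L2_norm M (\<lambda>x. f x + g x) < r + s"
    unfolding L2_norm_def using pos by (intro real_less_lsqrt) auto
  then show ?thesis using I by (auto simp: L2_def)
qed

lemma L2_uminus: "f \<in> L2 M \<Longrightarrow> (\<lambda>x. - f x) \<in> L2 M"
  by (auto simp: L2_def)

lemma L2_diff: "f \<in> L2 M \<Longrightarrow> g \<in> L2 M \<Longrightarrow> (\<lambda>x. f x - g x) \<in> L2 M"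
  using L2_add_norm_less[of f M "\<lambda>x. - g x", OF _ L2_uminus less_add_one less_add_one] by simp

lemma L2_norm_minus_commute: "L2_norm M (\<lambda>x. f x - g x) = L2_norm M (\<lambda>x. g x - f x)"
  by (simp add: L2_norm_def norm_minus_commute)

lemma L2_ball_open:
  assumes f: "f \<in> L2 M"
  shows "openin (L2_topology M) {g \<in> L2 M. L2_norm M (\<lambda>x. f x - g x) < r}"
  unfolding openin_L2_topology
proof (intro conjI ballI)
  fix g assume "g \<in> {g \<in> L2 M. L2_norm M (\<lambda>x. f x - g x) < r}"
  then have g: "g \<in> L2 M" and gr: "L2_norm M (\<lambda>x. f x - g x) < r" by auto
  obtain q where q: "L2_norm M (\<lambda>x. f x - g x) < q" "q < r" using dense[OF gr] by blast
  have "L2_norm M (\<lambda>x. f x - h x) < r" if h: "h \<in> L2 M" "L2_norm M (\<lambda>x. g x - h x) < r - q" for h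
    using L2_add_norm_less[OF L2_diff[OF f g] L2_diff[OF g h(1)] q(1) h(2)] by simp
  then show "\<exists>e>0. \<forall>h\<in>L2 M. L2_norm M (\<lambda>x. g x - h x) < e \<longrightarrow>
      h \<in> {g \<in> L2 M. L2_norm M (\<lambda>x. f x - g x) < r}"
    using q(2) by (intro exI[of _ "r - q"]) auto
qed auto

lemma in_closure_of_L2_subtopology:
  assumes "S \<subseteq> L2 M"
  shows "f \<in> subtopology (L2_topology M) S closure_of A \<longleftrightarrow>
    f \<in> S \<and> (\<forall>e>0. \<exists>g\<in>A \<inter> S. L2_norm M (\<lambda>x. f x - g x) < e)"
proof -
  have "f \<in> L2_topology M closure_of B \<longleftrightarrow> (\<forall>e>0. \<exists>g\<in>B. L2_norm M (\<lambda>x. f x - g x) < e)"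
    if f: "f \<in> L2 M" and B: "B \<subseteq> L2 M" for B
  proof
    assume "f \<in> L2_topology M closure_of B"
    then have *: "\<exists>y. y \<in> B \<and> y \<in> U" if "f \<in> U" "openin (L2_topology M) U" for U
      using that unfolding in_closure_of by blast
    show "\<forall>e>0. \<exists>g\<in>B. L2_norm M (\<lambda>x. f x - g x) < e"
    proof (intro allI impI)
      fix e :: real assume "e > 0"
      then have "f \<in> {g \<in> L2 M. L2_norm M (\<lambda>x. f x - g x) < e}"
        using f by (simp add: L2_norm_def)
      from *[OF this L2_ball_open[OF f]] show "\<exists>g\<in>B. L2_norm M (\<lambda>x. f x - g x) < e"
        by blast
    qed
  next
    assume "\<forall>e>0. \<exists>g\<in>B. L2_norm M (\<lambda>x. f x - g x) < e"
    then show "f \<in> L2_topology M closure_of B"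
      using f B unfolding in_closure_of openin_L2_topology topspace_L2_topology
      by (meson subsetD)
  qed
  moreover have "S \<inter> A \<subseteq> L2 M" using assms by blast
  ultimately show ?thesis
    using assms by (auto simp: closure_of_subtopology Int_commute)
qed


section \<open>The reachable set and its closure\<close>

text \<open>The functions in \<open>L\<^sup>2(\<real>\<^sup>2)\<close> that are (almost everywhere) even in the first coordinate.\<close>

definition Hhat0 :: "(real^2 \<Rightarrow> complex) set" where
  "Hhat0 = {f \<in> L2 lebesgue. AE x in lebesgue. f (vector [- (x$1), x$2]) = f x}"

definition radial_H :: "(real^2 \<Rightarrow> complex) set" where
  "radial_H = {f \<in> L2 lebesgue. \<exists>g\<in>L2 (lebesgue_on {0<..}). AE x in lebesgue. f x = g ((norm x)\<^sup>2)}"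

text \<open>At \<open>x = 0\<close> the integrand need not be integrable, in which case the value is \<open>0\<close>;
  this concerns a null set only.\<close>

definition final_state :: "(real \<Rightarrow> complex) \<Rightarrow> real \<Rightarrow> real^2 \<Rightarrow> complex" where
  "final_state u T x = - (1 / of_real pi) *
     (LINT \<xi>:{0<..<T}|lebesgue.
        of_real (1 / (2 * \<xi>) * exp (- ((norm x)\<^sup>2 / (4 * \<xi>)))) * u (T - \<xi>))"

definition reachable_from_0 :: "real \<Rightarrow> (real^2 \<Rightarrow> complex) set" where
  "reachable_from_0 T = {final_state u T | u. u \<in> Linf (lebesgue_on {0<..<T})}"

end

(*
  In the variable r = |x|^2 the plane measure becomes pi dr on (0, oo), so radial functions form a
  copy of L^2(0, oo); this subspace is closed because L^2 convergence gives a.e. convergence along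
  a subsequence.  For density, put b = 1/T and let u (T - xi) be a multiple of 1/xi on the interval
  1/(4 (b + k + 1)) <= xi <= 1/(4 (b + k)).  The corresponding final state is a multiple of
  w(r) exp(-k r) with the single weight w(r) = exp(-b r) (1 - exp(-r)) / r.  Density thus reduces to
  density of polynomials in exp(-r) in the weighted space L^2(w(r)^2 dr), which has finite mass, and
  there it follows from the Weierstrass theorem on [0, 1].
*)

theory Submission
  imports Defs
begin

section \<open>Radial functions on the plane\<close>

text \<open>The image of planar Lebesgue measure under the squared norm. It lives on the whole line,
  with the half line built into the density, so that it can equal a \<open>distr\<close> into
  \<open>borel\<close>.\<close>

definition radial_measure :: "real measure" where
  "radial_measure = density lborel (\<lambda>r. ennreal (pi * indicator {0<..} r))"

lemma sets_radial_measure [simp, measurable_cong]: "sets radial_measure = sets borel"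
  and space_radial_measure [simp]: "space radial_measure = UNIV"
  by (auto simp: radial_measure_def)

lemma AE_radial_measure_iff: "(AE r in radial_measure. P r) \<longleftrightarrow> (AE r in lborel. r > 0 \<longrightarrow> P r)"
  unfolding radial_measure_def
  by (subst AE_density) (auto simp: indicator_def intro!: AE_cong)

lemma emeasure_radial_measure_lessThan: "emeasure radial_measure {..<a} = ennreal (pi * max 0 a)"
proof -
  have "emeasure radial_measure {..<a} = (\<integral>\<^sup>+ r. ennreal pi * indicator {0<..<a} r \<partial>lborel)"
    unfolding radial_measure_def
    by (subst emeasure_density) (auto intro!: nn_integral_cong split: split_indicator)
  also have "\<dots> = ennreal (pi * max 0 a)"
    by (subst nn_integral_cmult_indicator) (auto simp: ennreal_mult max_def)
  finally show ?thesis .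
qed

text \<open>The half lines \<open>{..<a}\<close> form an intersection-stable generator of the Borel
  sets, and for a > 0 their preimages are discs of area pi a. Uniqueness follows since the sets
  \<open>{..<real n}\<close> exhaust the line with finite measure.\<close>

lemma distr_norm_power2:
  "distr (lborel :: (real^2) measure) borel (\<lambda>x. (norm x)\<^sup>2) = radial_measure"
proof (rule measure_eqI_generator_eq[where E = "range lessThan" and \<Omega> = UNIV and A = "\<lambda>n. {..<real n}"])
  show "Int_stable (range (lessThan :: real \<Rightarrow> real set))"
  proof -
    have "{..<a} \<inter> {..<b} = {..<min a b}" for a b :: real by auto
    then show ?thesis by (auto simp: Int_stable_def)
  qed
  show "sets (distr (lborel :: (real^2) measure) borel (\<lambda>x. (norm x)\<^sup>2)) = sigma_sets UNIV (range lessThan)"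
    "sets radial_measure = sigma_sets UNIV (range lessThan)"
    by (simp_all add: borel_Iio)
  fix X assume "X \<in> range (lessThan :: real \<Rightarrow> real set)"
  then obtain a where X: "X = {..<a}" by auto
  have "emeasure (distr (lborel :: (real^2) measure) borel (\<lambda>x. (norm x)\<^sup>2)) X =
      emeasure lborel ((\<lambda>x::real^2. (norm x)\<^sup>2) -` {..<a})"
    unfolding X by (subst emeasure_distr) auto
  \<comment> \<open>For a \<le> 0 the preimage is empty, and so is the ball of radius 0.\<close>
  also have "(\<lambda>x::real^2. (norm x)\<^sup>2) -` {..<a} = ball 0 (sqrt (max 0 a))"
  proof -
    have "(norm x)\<^sup>2 < a \<longleftrightarrow> norm x < sqrt (max 0 a)" for x :: "real^2"
    proof (cases "a > 0")
      case True
      then show ?thesis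
        using real_sqrt_less_iff[of "(norm x)\<^sup>2" a] by (simp del: real_sqrt_less_iff)
    next
      case False
      then have "\<not> (norm x)\<^sup>2 < a"
        using zero_le_power2[of "norm x"] by linarith
      then show ?thesis using False by simp
    qed
    then show ?thesis by (auto simp: dist_norm)
  qed
  also have "emeasure lborel \<dots> = ennreal (pi * max 0 a)"
    by (subst emeasure_ball) (auto simp: unit_ball_vol_2)
  finally show "emeasure (distr (lborel :: (real^2) measure) borel (\<lambda>x. (norm x)\<^sup>2)) X =
      emeasure radial_measure X"
    by (simp add: X emeasure_radial_measure_lessThan)
next
  show "(\<Union>n. {..<real n}) = UNIV"
    using reals_Archimedean2 by auto
  show "emeasure (distr (lborel :: (real^2) measure) borel (\<lambda>x. (norm x)\<^sup>2)) {..<real n} \<noteq> \<infinity>" for n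
  proof -
    have "emeasure (distr (lborel :: (real^2) measure) borel (\<lambda>x. (norm x)\<^sup>2)) {..<real n} =
      emeasure lborel ((\<lambda>x::real^2. (norm x)\<^sup>2) -` {..<real n})"
      by (subst emeasure_distr) auto
    also have "\<dots> \<le> emeasure lborel (ball (0::real^2) (sqrt (real n)))"
      by (intro emeasure_mono) (auto simp: real_less_rsqrt)
    also have "\<dots> < \<infinity>" by (subst emeasure_ball) auto
    finally show ?thesis by simp
  qed
qed auto

lemma AE_norm_power2:
  assumes "AE r in radial_measure. P r"
  shows "AE x::real^2 in lebesgue. P ((norm x)\<^sup>2)"
proof -
  have "AE x::real^2 in lborel. P ((norm x)\<^sup>2)"
    by (rule AE_distrD[OF _ assms[folded distr_norm_power2]]) simp
  then show ?thesis by (rule AE_completion)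
qed

lemma AE_norm_power2_pos: "AE x::real^2 in lebesgue. (norm x)\<^sup>2 > 0"
  by (rule AE_norm_power2) (simp add: AE_radial_measure_iff)

lemma measurable_radial [measurable (raw)]:
  "h \<in> borel_measurable borel \<Longrightarrow> (\<lambda>x::real^2. h ((norm x)\<^sup>2)) \<in> borel_measurable borel"
  by (rule measurable_compose[where N = borel]) auto

lemma integrable_radial_iff:
  fixes h :: "real \<Rightarrow> real"
  assumes "h \<in> borel_measurable borel"
  shows "integrable lebesgue (\<lambda>x::real^2. h ((norm x)\<^sup>2)) \<longleftrightarrow> integrable radial_measure h"
  unfolding distr_norm_power2[symmetric] using assms
  by (subst integrable_distr_eq) (auto simp: integrable_completion)

lemma integral_radial:
  fixes h :: "real \<Rightarrow> real"
  assumes "h \<in> borel_measurable borel"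
  shows "(LINT x|lebesgue. h ((norm (x::real^2))\<^sup>2)) = integral\<^sup>L radial_measure h"
  unfolding distr_norm_power2[symmetric] using assms
  by (subst integral_distr) (auto simp: integral_completion)

section \<open>Borel profiles of radial functions\<close>

lemma completion_ex_borel_measurable_complex:
  fixes g :: "'a \<Rightarrow> complex"
  assumes "g \<in> borel_measurable (completion M)"
  obtains g' where "g' \<in> borel_measurable M" "AE x in M. g x = g' x"
proof -
  have "(\<lambda>x. Re (g x)) \<in> borel_measurable (completion M)" "(\<lambda>x. Im (g x)) \<in> borel_measurable (completion M)"
    using assms by measurable
  from this[THEN completion_ex_borel_measurable_real] obtain a b
    where [measurable]: "a \<in> borel_measurable M" "b \<in> borel_measurable M"
      and ae: "AE x in M. Re (g x) = a x" "AE x in M. Im (g x) = b x"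
    by blast
  show ?thesis
  proof (rule that)
    show "(\<lambda>x. Complex (a x) (b x)) \<in> borel_measurable M"
      by (simp add: borel_measurable_complex_iff)
    show "AE x in M. g x = Complex (a x) (b x)"
      using ae by eventually_elim (simp add: complex_eq_iff)
  qed
qed

lemma L2_cong_AE:
  assumes f: "f \<in> L2 M" and ae: "AE x in M. f x = g x"
    and g: "g \<in> borel_measurable M"
  shows "g \<in> L2 M"
proof -
  have "integrable M (\<lambda>x. (cmod (f x))\<^sup>2) \<longleftrightarrow> integrable M (\<lambda>x. (cmod (g x))\<^sup>2)"
    using f g ae unfolding L2_def by (intro integrable_cong_AE) auto
  then show ?thesis using f g by (auto simp: L2_def)
qed

lemma L2_norm_cong_AE:
  assumes "f \<in> borel_measurable M" "g \<in> borel_measurable M" and ae: "AE x in M. f x = g x"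
  shows "L2_norm M f = L2_norm M g"
proof -
  have "(LINT x|M. (cmod (f x))\<^sup>2) = (LINT x|M. (cmod (g x))\<^sup>2)"
    using assms by (intro integral_cong_AE) auto
  then show ?thesis by (simp add: L2_norm_def)
qed

text \<open>A Borel profile stays measurable under composition with the squared norm, so integrals
  can be moved between plane and line. Its square integrability on the half line then comes from
  that of \<open>f\<close> by the change of variables.\<close>

lemma radial_H_iff:
  "f \<in> radial_H \<longleftrightarrow> f \<in> L2 lebesgue \<and>
     (\<exists>g\<in>borel_measurable borel. AE x in lebesgue. f x = g ((norm x)\<^sup>2))"
proof (intro iffI conjI; (elim conjE)?)
  assume f: "f \<in> radial_H"
  then show "f \<in> L2 lebesgue" by (simp add: radial_H_def)
  from f obtain g where g: "g \<in> L2 (lebesgue_on {0<..})" and fg: "AE x in lebesgue. f x = g ((norm x)\<^sup>2)"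
    by (auto simp: radial_H_def)
  \<comment> \<open>Extension by zero gives a function on the whole line; its values at r \<le> 0
    are not seen by \<open>radial_measure\<close>.\<close>
  have "(\<lambda>r. if r \<in> {0<..} then g r else 0) \<in> borel_measurable lebesgue"
    using g by (intro borel_measurable_if_I) (auto simp: L2_def)
  then obtain g' where g': "g' \<in> borel_measurable lborel" "AE r in lborel. (if r \<in> {0<..} then g r else 0) = g' r"
    by (rule completion_ex_borel_measurable_complex)
  have "AE r in radial_measure. g r = g' r"
    unfolding AE_radial_measure_iff using g'(2) by eventually_elim auto
  then have "AE x::real^2 in lebesgue. g ((norm x)\<^sup>2) = g' ((norm x)\<^sup>2)"
    by (rule AE_norm_power2)
  with fg have "AE x in lebesgue. f x = g' ((norm x)\<^sup>2)"
    by eventually_elim simp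
  then show "\<exists>g\<in>borel_measurable borel. AE x in lebesgue. f x = g ((norm x)\<^sup>2)"
    using g'(1) by auto
next
  assume f: "f \<in> L2 lebesgue"
    and "\<exists>g\<in>borel_measurable borel. AE x in lebesgue. f x = g ((norm x)\<^sup>2)"
  then obtain g where [measurable]: "g \<in> borel_measurable borel"
    and fg: "AE x in lebesgue. f x = g ((norm x)\<^sup>2)" by blast
  have "(\<lambda>x::real^2. g ((norm x)\<^sup>2)) \<in> L2 lebesgue"
    by (rule L2_cong_AE[OF f fg]) (auto intro!: measurable_completion)
  then have "integrable radial_measure (\<lambda>r. (cmod (g r))\<^sup>2)"
    by (auto simp: L2_def integrable_radial_iff[where h="\<lambda>r. (cmod (g r))\<^sup>2"])
  then have "integrable lborel (\<lambda>r. (pi * indicator {0<..} r) *\<^sub>R (cmod (g r))\<^sup>2)"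
    unfolding radial_measure_def by (subst (asm) integrable_density) auto
  then have "integrable lborel (\<lambda>r. indicator {0<..} r *\<^sub>R (cmod (g r))\<^sup>2)"
    by (simp add: mult.assoc)
  then have "integrable (lebesgue_on {0<..}) (\<lambda>r. (cmod (g r))\<^sup>2)"
    by (subst integrable_restrict_space) (auto simp: integrable_completion)
  then have "g \<in> L2 (lebesgue_on {0<..})"
    by (auto simp: L2_def intro!: measurable_restrict_space1 measurable_completion)
  then show "f \<in> radial_H"
    using f fg by (auto simp: radial_H_def)
qed

lemma L2_radial_iff:
  assumes [measurable]: "h \<in> borel_measurable borel"
  shows "(\<lambda>x::real^2. h ((norm x)\<^sup>2)) \<in> L2 lebesgue \<longleftrightarrow> h \<in> L2 radial_measure"
  using integrable_radial_iff[where h="\<lambda>r. (cmod (h r))\<^sup>2"]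
  by (auto simp: L2_def intro!: measurable_completion)

lemma L2_norm_radial:
  assumes [measurable]: "h \<in> borel_measurable borel"
  shows "L2_norm lebesgue (\<lambda>x::real^2. h ((norm x)\<^sup>2)) = L2_norm radial_measure h"
  using integral_radial[where h="\<lambda>r. (cmod (h r))\<^sup>2"] by (simp add: L2_norm_def)

text \<open>The reflection preserves norms, so it leaves the value of the profile unchanged. The
  a.e. statement survives because a linear map of the plane sends negligible sets to negligible
  sets.\<close>

lemma radial_H_subset_Hhat0: "radial_H \<subseteq> Hhat0"
proof
  fix f assume "f \<in> radial_H"
  then obtain g where f: "f \<in> L2 lebesgue" and fg: "AE x in lebesgue. f x = g ((norm x)\<^sup>2)"
    by (auto simp: radial_H_def)
  define R :: "real^2 \<Rightarrow> real^2" where "R x = vector [- (x$1), x$2]" for x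
  have lin: "linear R"
    by (auto simp: R_def linear_iff vec_eq_iff forall_2 vector_2)
  have RR: "R (R x) = x" and nR: "norm (R x) = norm x" for x
    by (auto simp: R_def vec_eq_iff forall_2 vector_2 norm_eq_sqrt_inner inner_vec_def sum_2)
  have "AE x in lebesgue. f (R x) = g ((norm (R x))\<^sup>2)"
  proof -
    define N where "N = {x. f x \<noteq> g ((norm x)\<^sup>2)}"
    have "negligible N"
      using fg by (simp add: N_def negligible_iff_null_sets completion.AE_iff_null_sets)
    then have "negligible (R ` N)"
      using lin by (intro negligible_differentiable_image_negligible) 
        (auto intro: linear_imp_differentiable_on)
    \<comment> \<open>\<open>R\<close> is an involution, so the exceptional set for
      \<open>f (R x)\<close> lies in the image of \<open>N\<close>.\<close>
    moreover have "{x. \<not> f (R x) = g ((norm (R x))\<^sup>2)} \<subseteq> R ` N"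
      using RR by (force simp: N_def image_iff)
    ultimately show ?thesis
      unfolding completion.AE_iff_null_sets negligible_iff_null_sets[symmetric]
      by (auto intro: negligible_subset)
  qed
  with fg have "AE x in lebesgue. f (R x) = f x"
    by eventually_elim (simp add: nR)
  then show "f \<in> Hhat0" using f by (simp add: Hhat0_def R_def)
qed

section \<open>Closedness of the radial functions and the upper inclusion\<close>

lemma (in complete_measure) measurable_AE_cong:
  assumes f: "f \<in> M \<rightarrow>\<^sub>M N" and g: "g \<in> space M \<rightarrow> space N" and ae: "AE x in M. f x = g x"
  shows "g \<in> M \<rightarrow>\<^sub>M N"
proof (rule measurableI)
  fix A assume "A \<in> sets N"
  then have A: "f -` A \<inter> space M \<in> sets M"
    using f by (rule measurable_sets[rotated])
  have "AE x in M. x \<in> f -` A \<inter> space M \<longleftrightarrow> x \<in> g -` A \<inter> space M"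
    using ae by eventually_elim auto
  \<comment> \<open>Completeness makes a set measurable once it agrees a.e. with a measurable
    one.\<close>
  then show "g -` A \<inter> space M \<in> sets M"
    using A by (rule in_sets_AE) (rule Int_lower2)
qed (use g in blast)

text \<open>Along an approximating sequence the squared distances tend to 0 in L1, hence a.e. along
  a subsequence. The limit of the corresponding Borel profiles is then a profile of
  \<open>f\<close>.\<close>

lemma radial_H_closed:
  assumes f: "f \<in> L2 lebesgue"
    and approx: "\<And>e. e > 0 \<Longrightarrow> \<exists>g\<in>radial_H. L2_norm lebesgue (\<lambda>x. f x - g x) < e"
  shows "f \<in> radial_H"
proof -
  have "\<forall>n. \<exists>g. g \<in> radial_H \<and> L2_norm lebesgue (\<lambda>x. f x - g x) < 1 / real (Suc n)"
    using approx[of "1 / real (Suc n)" for n] by (auto simp: Bex_def simp del: of_nat_Suc)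
  from choice[OF this] obtain g where g: "\<And>n. g n \<in> radial_H"
    and less: "\<And>n. L2_norm lebesgue (\<lambda>x. f x - g n x) < 1 / real (Suc n)"
    by blast
  have "\<forall>n. \<exists>G. G \<in> borel_measurable borel \<and> (AE x in lebesgue. g n x = G ((norm x)\<^sup>2))"
    using g unfolding radial_H_iff by blast
  from choice[OF this] obtain G where [measurable]: "\<And>n. G n \<in> borel_measurable borel"
    and gG: "\<And>n. AE x in lebesgue. g n x = G n ((norm x)\<^sup>2)"
    by blast
  have L2: "(\<lambda>x. f x - g n x) \<in> L2 lebesgue" for n
    using f g by (auto intro: L2_diff simp: radial_H_def)
  have "(\<lambda>n. (L2_norm lebesgue (\<lambda>x. f x - g n x))\<^sup>2) \<longlonglongrightarrow> 0\<^sup>2"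
  proof (intro tendsto_power)
    show "(\<lambda>n. L2_norm lebesgue (\<lambda>x. f x - g n x)) \<longlonglongrightarrow> 0"
      using less
      by (intro tendsto_sandwich[OF _ _ tendsto_const LIMSEQ_Suc[OF lim_1_over_n]])
        (auto intro!: always_eventually less_imp_le simp: L2_norm_def)
  qed
  then have "(\<lambda>n. LINT x|lebesgue. norm ((cmod (f x - g n x))\<^sup>2)) \<longlonglongrightarrow> 0"
    by (simp add: L2_norm_def)
  from tendsto_L1_AE_subseq[OF _ this] L2 obtain r :: "nat \<Rightarrow> nat"
    where lim: "AE x in lebesgue. (\<lambda>n. (cmod (f x - g (r n) x))\<^sup>2) \<longlonglongrightarrow> 0"
    by (auto simp: L2_def)
  have "AE x in lebesgue. \<forall>n. g n x = G n ((norm x)\<^sup>2)"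
    using gG by (simp add: AE_all_countable)
  with lim have "AE x in lebesgue. f x = lim (\<lambda>n. G (r n) ((norm x)\<^sup>2))"
  proof eventually_elim
    case (elim x)
    have "(\<lambda>n. sqrt ((cmod (f x - g (r n) x))\<^sup>2)) \<longlonglongrightarrow> sqrt 0"
      using elim(1) by (rule tendsto_real_sqrt)
    then have "(\<lambda>n. f x - g (r n) x) \<longlonglongrightarrow> 0"
      by (simp add: tendsto_norm_zero_iff)
    from tendsto_diff[OF tendsto_const[of "f x"] this]
    have "(\<lambda>n. G (r n) ((norm x)\<^sup>2)) \<longlonglongrightarrow> f x"
      using elim(2) by simp
    then show ?case by (simp add: limI)
  qed
  \<comment> \<open>Where the profiles diverge, \<open>lim\<close> takes a fixed unspecified value,
    which does not spoil Borel measurability.\<close>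
  moreover have "(\<lambda>s. lim (\<lambda>n. G (r n) s)) \<in> borel_measurable borel"
    by measurable
  ultimately show ?thesis
    using f unfolding radial_H_iff by (intro conjI bexI[where x = "\<lambda>s. lim (\<lambda>n. G (r n) s)"])
qed

text \<open>The integral depends on \<open>x\<close> through the squared norm only; the point is
  Borel measurability of the profile. The control is only Lebesgue measurable, so a Borel version
  replaces it and makes the integrand jointly measurable in r and \<xi>.\<close>

lemma final_state_radial:
  assumes u: "u \<in> borel_measurable (lebesgue_on {0<..<T})"
  obtains G where "G \<in> borel_measurable borel" "\<And>x. final_state u T x = G ((norm x)\<^sup>2)"
proof -
  define v where "v \<xi> = (if \<xi> \<in> {0<..<T} then u \<xi> else 0)" for \<xi>
  have "v \<in> borel_measurable lebesgue"
    unfolding v_def using u by (rule borel_measurable_if_I) simp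
  then obtain w where w[measurable]: "w \<in> borel_measurable lborel" and "AE \<xi> in lborel. v \<xi> = w \<xi>"
    by (rule completion_ex_borel_measurable_complex)
  then obtain N where N: "{\<xi>. v \<xi> \<noteq> w \<xi>} \<subseteq> N" "N \<in> null_sets lborel"
    by (auto simp: eventually_ae_filter)
  have [measurable]: "N \<in> sets borel"
    using N(2) by auto
  \<comment> \<open>The reflection of \<xi> to T - \<xi> preserves null sets; it is written in the
    affine form that the rule expects.\<close>
  have "AE \<xi> in lborel. T + (-1) * \<xi> \<notin> N"
    using N(2) by (intro AE_borel_affine) (auto intro: AE_not_in)
  then have vw: "AE \<xi> in lborel. v (T - \<xi>) = w (T - \<xi>)"
    by eventually_elim (use N(1) in auto)
  define K where "K r \<xi> = indicator {0<..<T} \<xi> *\<^sub>R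
    (complex_of_real (1 / (2 * \<xi>) * exp (- (r / (4 * \<xi>)))) * w (T - \<xi>))" for r \<xi>
  define G where "G r = - (1 / of_real pi) * (LINT \<xi>|lborel. K r \<xi>)" for r
  have K[measurable]: "(\<lambda>(r, \<xi>). K r \<xi>) \<in> borel_measurable (borel \<Otimes>\<^sub>M lborel)"
    unfolding K_def by measurable
  have Kr: "K r \<in> borel_measurable lborel" for r
    using measurable_compose[OF measurable_Pair1' K, of r] by simp
  show ?thesis
  proof (rule that)
    show "G \<in> borel_measurable borel"
      unfolding G_def by measurable
    show "final_state u T x = G ((norm x)\<^sup>2)" for x
    proof -
      define F where "F \<xi> = indicator {0<..<T} \<xi> *\<^sub>R
        (complex_of_real (1 / (2 * \<xi>) * exp (- ((norm x)\<^sup>2 / (4 * \<xi>)))) * u (T - \<xi>))" for \<xi>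
      have "AE \<xi> in lborel. K ((norm x)\<^sup>2) \<xi> = F \<xi>"
        using vw by eventually_elim (auto simp: K_def F_def v_def indicator_def)
      then have ae: "AE \<xi> in lebesgue. K ((norm x)\<^sup>2) \<xi> = F \<xi>"
        by (rule AE_completion)
      have K': "K ((norm x)\<^sup>2) \<in> borel_measurable lebesgue"
        using Kr by (rule measurable_completion)
      \<comment> \<open>\<open>F\<close> is measurable since it agrees a.e. with \<open>K\<close>
        and Lebesgue measure is complete. If the two are not integrable, both integrals take the
        default value 0.\<close>
      have "integral\<^sup>L lebesgue F = integral\<^sup>L lebesgue (K ((norm x)\<^sup>2))"
        using ae K' completion.measurable_AE_cong[OF K' _ ae]
        by (intro integral_cong_AE) (auto elim: eventually_mono)
      also have "\<dots> = integral\<^sup>L lborel (K ((norm x)\<^sup>2))"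
        using Kr by (rule integral_completion)
      finally show ?thesis
        unfolding final_state_def set_lebesgue_integral_def G_def F_def[abs_def] by (simp only:)
    qed
  qed
qed

text \<open>Closure in the subspace is tested on reachable states lying in \<open>Hhat0\<close>.
  These are square integrable, hence radial by \<open>final_state_radial\<close>, and
  \<open>radial_H\<close> is closed under \<open>L2\<close> limits.\<close>

lemma closure_reachable_subset:
  "subtopology (L2_topology lebesgue) Hhat0 closure_of reachable_from_0 T \<subseteq> radial_H"
proof
  fix f assume f: "f \<in> subtopology (L2_topology lebesgue) Hhat0 closure_of reachable_from_0 T"
  have sub: "Hhat0 \<subseteq> L2 lebesgue" by (auto simp: Hhat0_def)
  have reach: "g \<in> radial_H" if g: "g \<in> reachable_from_0 T" "g \<in> Hhat0" for g
  proof -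
    from g obtain u where u: "u \<in> borel_measurable (lebesgue_on {0<..<T})" "g = final_state u T"
      by (auto simp: reachable_from_0_def Linf_def)
    obtain G where "G \<in> borel_measurable borel" "\<And>x. g x = G ((norm x)\<^sup>2)"
      using final_state_radial[OF u(1)] u(2) by metis
    then show ?thesis
      unfolding radial_H_iff using g sub by blast
  qed
  note closure = iffD1[OF in_closure_of_L2_subtopology[OF sub] f]
  have "f \<in> Hhat0"
    using closure by (rule conjunct1)
  have approx: "\<exists>g\<in>reachable_from_0 T \<inter> Hhat0. L2_norm lebesgue (\<lambda>x. f x - g x) < e" if "e > 0" for e
    using conjunct2[OF closure] that by (elim allE impE)
  show "f \<in> radial_H"
  proof (rule radial_H_closed)
    show "f \<in> L2 lebesgue" using sub \<open>f \<in> Hhat0\<close> by (rule subsetD)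
    fix e :: real assume "e > 0"
    then obtain g where "g \<in> reachable_from_0 T" "g \<in> Hhat0" "L2_norm lebesgue (\<lambda>x. f x - g x) < e"
      using approx by blast
    then show "\<exists>g\<in>radial_H. L2_norm lebesgue (\<lambda>x. f x - g x) < e"
      by (intro bexI[where x = g] reach)
  qed
qed

section \<open>Polynomials in an exponential\<close>

text \<open>The substitution y = exp (-r) maps r \<ge> 0 onto the interval (0, 1]. Since
  \<open>h\<close> vanishes for large r, the transported function extends continuously by 0 to y =
  0, and polynomials in y approximate it uniformly on [0, 1].\<close>

lemma Weierstrass_exp:
  fixes h :: "real \<Rightarrow> complex"
  assumes h: "continuous_on UNIV h" and zero: "\<And>r. r \<ge> b \<Longrightarrow> h r = 0" and "e > 0"
  obtains c :: "nat \<Rightarrow> complex" and n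
    where "\<And>r. r \<ge> 0 \<Longrightarrow> cmod (h r - (\<Sum>k\<le>n. c k * of_real (exp (- r) ^ k))) < e"
proof -
  define H where "H y = (if y \<le> exp (- b) then 0 else h (- ln y))" for y
  have ln_cont: "continuous_on {exp (- b)..1} (\<lambda>y. h (- ln y))"
    using less_le_trans[OF exp_gt_zero]
    by (intro continuous_on_compose2[OF h] continuous_intros) (auto simp: less_imp_neq[symmetric])
  \<comment> \<open>The two pieces agree at y = exp (-b) because \<open>h b = 0\<close>. If b < 0,
    the first interval alone covers [0, 1].\<close>
  have "continuous_on ({0..exp (- b)} \<union> {exp (- b)..1}) H"
    unfolding H_def using ln_cont by (intro continuous_on_cases) (auto simp: zero)
  then have H: "continuous_on {0..1} H"
    by (rule continuous_on_subset) auto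
  \<comment> \<open>Real and imaginary part are approximated separately, each within e / 2; the
    modulus is at most the sum of the two errors.\<close>
  have "continuous_on {0..1} (\<lambda>y. Re (H y))" "continuous_on {0..1} (\<lambda>y. Im (H y))"
    using H by (auto intro: continuous_intros)
  then obtain p q
    where "real_polynomial_function p" and p: "\<And>y. y \<in> {0..1} \<Longrightarrow> \<bar>Re (H y) - p y\<bar> < e / 2"
      and "real_polynomial_function q" and q: "\<And>y. y \<in> {0..1} \<Longrightarrow> \<bar>Im (H y) - q y\<bar> < e / 2"
    using Stone_Weierstrass_real_polynomial_function[OF compact_Icc _ half_gt_zero[OF \<open>e > 0\<close>]]
    by metis
  then obtain a m a' m' where pa: "p = (\<lambda>y. \<Sum>i\<le>m. a i * y ^ i)" and qa: "q = (\<lambda>y. \<Sum>i\<le>m'. a' i * y ^ i)"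
    unfolding real_polynomial_function_iff_sum by blast
  \<comment> \<open>Both coefficient sequences are padded with zeros to a common degree.\<close>
  define n where "n = max m m'"
  define c where "c k = Complex (if k \<le> m then a k else 0) (if k \<le> m' then a' k else 0)" for k
  have p': "p y = (\<Sum>k\<le>n. Re (c k) * y ^ k)" and q': "q y = (\<Sum>k\<le>n. Im (c k) * y ^ k)" for y
    unfolding pa qa by (rule sum.mono_neutral_cong_left; auto simp: n_def c_def)+
  show ?thesis
  proof (rule that)
    fix r :: real assume "r \<ge> 0"
    define z where "z = h r - (\<Sum>k\<le>n. c k * of_real (exp (- r) ^ k))"
    have y: "exp (- r) \<in> {0..1}" and Hy: "H (exp (- r)) = h r"
      using \<open>r \<ge> 0\<close> zero by (auto simp: H_def)
    have "Re z = Re (H (exp (- r))) - p (exp (- r))" "Im z = Im (H (exp (- r))) - q (exp (- r))"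
      unfolding z_def p' q' Hy by (simp_all flip: of_real_power)
    then show "cmod z < e"
      using cmod_le[of z] p[OF y] q[OF y] by linarith
  qed
qed

text \<open>Truncation makes \<open>f\<close> bounded and zero for large r; the truncated function
  is an a.e. limit of continuous functions, which are clipped to keep the bound. Dominated
  convergence controls both limits, the second one with a constant, integrable because
  \<open>M\<close> is finite.\<close>

lemma L2_approx_continuous:
  fixes M :: "real measure"
  assumes "finite_measure M" and sets[measurable_cong]: "sets M = sets borel"
    and ac: "null_sets lborel \<subseteq> null_sets M" and f: "f \<in> L2 M" and "e > 0"
  obtains h b where "continuous_on UNIV h" "\<And>r. r \<ge> b \<Longrightarrow> h r = 0"
    "h \<in> L2 M" "L2_norm M (\<lambda>r. f r - h r) < e"
proof -
  interpret finite_measure M by fact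
  have f_meas [measurable]: "f \<in> borel_measurable M" and f_int: "integrable M (\<lambda>r. (cmod (f r))\<^sup>2)"
    using f by (auto simp: L2_def)
  define F where "F m r = (if cmod (f r) \<le> real m \<and> r \<le> real m then f r else 0)" for m r
  have F_meas [measurable]: "F m \<in> borel_measurable M" for m
    unfolding F_def by measurable
  have F_L2: "F m \<in> L2 M" for m
    unfolding L2_def
    by (auto simp: F_def intro!: Bochner_Integration.integrable_bound[OF f_int])
  have "(\<lambda>m. LINT r|M. (cmod (f r - F m r))\<^sup>2) \<longlonglongrightarrow> (LINT r|M. 0)"
  proof (rule integral_dominated_convergence[OF _ _ f_int])
    show "AE r in M. (\<lambda>m. (cmod (f r - F m r))\<^sup>2) \<longlonglongrightarrow> 0"
    proof (intro AE_I2 tendsto_eventually)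
      fix r
      obtain k :: nat where "max (cmod (f r)) r \<le> real k" using real_arch_simple by blast
      then show "\<forall>\<^sub>F m in sequentially. (cmod (f r - F m r))\<^sup>2 = 0"
        by (intro eventually_sequentiallyI[of k]) (auto simp: F_def)
    qed
  qed (auto simp: F_def)
  then have "(\<lambda>m. L2_norm M (\<lambda>r. f r - F m r)) \<longlonglongrightarrow> 0"
    unfolding L2_norm_def using tendsto_real_sqrt by fastforce
  then have "\<forall>\<^sub>F m in sequentially. L2_norm M (\<lambda>r. f r - F m r) < e / 2"
    using \<open>e > 0\<close> by (intro order_tendstoD(2)) auto
  then obtain m where m: "L2_norm M (\<lambda>r. f r - F m r) < e / 2"
    by (auto simp: eventually_sequentially)
  \<comment> \<open>The extra 1 lets \<open>cut\<close> fall from 1 at r = m to 0 at r = m + 1, and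
    keeps B positive when m = 0.\<close>
  define B where "B = real m + 1"
  have "B > 0" by (simp add: B_def)
  have "F m \<in> borel_measurable borel"
    using F_meas[of m] sets measurable_cong_sets by blast
  \<comment> \<open>The predicate \<open>measurable_on\<close> provides continuous functions
    converging to \<open>F m\<close> off a negligible set.\<close>
  then have "F m measurable_on UNIV"
    by (intro lebesgue_measurable_imp_measurable_on) (auto intro: measurable_completion)
  then obtain N g where N: "negligible N" and g: "\<And>n. continuous_on UNIV (g n)"
    and lim: "\<And>r. r \<notin> N \<Longrightarrow> (\<lambda>n. g n r) \<longlonglongrightarrow> F m r"
    unfolding measurable_on_def by auto
  \<comment> \<open>\<open>N\<close> is Lebesgue negligible; a Borel null superset of it is also
    null for \<open>M\<close>, by absolute continuity.\<close>
  from N have "AE r in lborel. r \<notin> N"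
    using AE_not_in[of N lebesgue] by (simp add: negligible_iff_null_sets AE_completion_iff)
  then obtain N' where "{r. r \<in> N} \<subseteq> N'" "N' \<in> null_sets lborel"
    by (auto simp: eventually_ae_filter)
  then have ae: "AE r in M. r \<notin> N"
    using ac by (intro AE_I'[where N = N']) auto
  define cut where "cut r = max 0 (min 1 (B - r))" for r
  \<comment> \<open>The factor \<open>B / max B (cmod (g n r))\<close> is continuous, brings values
    of modulus above B back to modulus B, and is 1 elsewhere.\<close>
  define h where "h n r = (cut r * (B / max B (cmod (g n r)))) *\<^sub>R g n r" for n r
  have h_cont: "continuous_on UNIV (h n)" for n
    unfolding h_def cut_def using \<open>B > 0\<close>
    by (intro continuous_intros g) auto
  then have h_meas [measurable]: "h n \<in> borel_measurable borel" for n
    by (rule borel_measurable_continuous_onI)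
  have h_le: "cmod (h n r) \<le> B" for n r
  proof -
    have "cmod (h n r) = cut r * (B / max B (cmod (g n r)) * cmod (g n r))"
      using \<open>B > 0\<close> by (simp add: h_def cut_def)
    also have "\<dots> \<le> 1 * B"
      using \<open>B > 0\<close> by (intro mult_mono) (auto simp: cut_def field_simps max_def)
    finally show ?thesis by simp
  qed
  have h_L2: "h n \<in> L2 M" for n
    unfolding L2_def using h_le
    by (auto intro!: integrable_const_bound[where B = "B\<^sup>2"] AE_I2 power_mono)
  have F_le: "cmod (F m r) \<le> B" for r by (auto simp: F_def B_def)
  have "(\<lambda>n. LINT r|M. (cmod (F m r - h n r))\<^sup>2) \<longlonglongrightarrow> (LINT r|M. 0)"
  proof (rule integral_dominated_convergence[where w = "\<lambda>_. (2 * B)\<^sup>2"])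
    show "AE r in M. (\<lambda>n. (cmod (F m r - h n r))\<^sup>2) \<longlonglongrightarrow> 0"
      using ae
    proof eventually_elim
      case (elim r)
      have "(\<lambda>n. h n r) \<longlonglongrightarrow> (cut r * (B / max B (cmod (F m r)))) *\<^sub>R F m r"
        unfolding h_def using \<open>B > 0\<close> by (intro tendsto_intros lim elim) auto
      \<comment> \<open>Where \<open>F m r\<close> is nonzero, r \<le> m and its modulus is at most
        m < B, so both scaling factors equal 1.\<close>
      also have "(cut r * (B / max B (cmod (F m r)))) *\<^sub>R F m r = F m r"
        using F_le[of r] \<open>B > 0\<close> by (auto simp: F_def cut_def B_def max_def)
      finally have "(\<lambda>n. (cmod (F m r - h n r))\<^sup>2) \<longlonglongrightarrow> (cmod (F m r - F m r))\<^sup>2"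
        by (intro tendsto_intros)
      then show ?case by simp
    qed
    show "AE r in M. norm ((cmod (F m r - h n r))\<^sup>2) \<le> (2 * B)\<^sup>2" for n
    proof (rule AE_I2)
      fix r
      have "cmod (F m r - h n r) \<le> 2 * B"
        using norm_triangle_ineq4[of "F m r" "h n r"] F_le[of r] h_le[of n r] by linarith
      then show "norm ((cmod (F m r - h n r))\<^sup>2) \<le> (2 * B)\<^sup>2"
        using power_mono[of "cmod (F m r - h n r)" "2 * B" 2] by simp
    qed
  qed auto
  then have "(\<lambda>n. L2_norm M (\<lambda>r. F m r - h n r)) \<longlonglongrightarrow> 0"
    unfolding L2_norm_def using tendsto_real_sqrt by fastforce
  then have "\<forall>\<^sub>F n in sequentially. L2_norm M (\<lambda>r. F m r - h n r) < e / 2"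
    using \<open>e > 0\<close> by (intro order_tendstoD(2)) auto
  then obtain n where n: "L2_norm M (\<lambda>r. F m r - h n r) < e / 2"
    by (auto simp: eventually_sequentially)
  show ?thesis
  proof (rule that[OF h_cont _ h_L2])
    show "h n r = 0" if "r \<ge> B" for r
      using that by (simp add: h_def cut_def)
    show "L2_norm M (\<lambda>r. f r - h n r) < e"
      using L2_add_norm_less[OF L2_diff[OF f F_L2] L2_diff[OF F_L2 h_L2] m n] by simp
  qed
qed

text \<open>After approximation by a continuous function, a uniform error d on r \<ge> 0 costs at
  most d times the square root of the total mass in the \<open>L2\<close> norm.\<close>

lemma L2_approx_exp_polynomial:
  fixes M :: "real measure"
  assumes "finite_measure M" and sets[measurable_cong]: "sets M = sets borel"
    and ac: "null_sets lborel \<subseteq> null_sets M" and pos: "AE r in M. r \<ge> 0"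
    and f: "f \<in> L2 M" and "e > 0"
  obtains c :: "nat \<Rightarrow> complex" and n where
    "(\<lambda>r. \<Sum>k\<le>n. c k * of_real (exp (- r) ^ k)) \<in> L2 M"
    "L2_norm M (\<lambda>r. f r - (\<Sum>k\<le>n. c k * of_real (exp (- r) ^ k))) < e"
proof -
  interpret finite_measure M by fact
  obtain h b where h: "continuous_on UNIV h" "\<And>r. r \<ge> b \<Longrightarrow> h r = 0"
    "h \<in> L2 M" "L2_norm M (\<lambda>r. f r - h r) < e / 2"
    using L2_approx_continuous[OF assms(1) sets ac f half_gt_zero[OF \<open>e > 0\<close>]] by blast
  have [measurable]: "h \<in> borel_measurable borel"
    using h(1) by (rule borel_measurable_continuous_onI)
  define C where "C = sqrt (measure M (space M))"
  have "C \<ge> 0" by (simp add: C_def)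
  \<comment> \<open>Using C + 1 keeps the denominator positive even for the zero measure and yields
    the strict bound d C < e / 2.\<close>
  define d where "d = e / (2 * (C + 1))"
  have "d > 0" using \<open>e > 0\<close> \<open>C \<ge> 0\<close> by (simp add: d_def)
  obtain c n where c: "\<And>r. r \<ge> 0 \<Longrightarrow> cmod (h r - (\<Sum>k\<le>n. c k * of_real (exp (- r) ^ k))) < d"
    using Weierstrass_exp[OF h(1,2) \<open>d > 0\<close>] by blast
  define D where "D r = h r - (\<Sum>k\<le>n. c k * of_real (exp (- r) ^ k))" for r
  have [measurable]: "D \<in> borel_measurable borel" unfolding D_def by measurable
  have bound: "AE r in M. (cmod (D r))\<^sup>2 \<le> d\<^sup>2"
    using pos by eventually_elim (use c in \<open>auto simp: D_def simp del: of_real_power intro!: power_mono[OF less_imp_le]\<close>)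
  have int: "integrable M (\<lambda>r. (cmod (D r))\<^sup>2)"
    using bound by (intro integrable_const_bound[where B = "d\<^sup>2"]) auto
  have D: "D \<in> L2 M" using int by (auto simp: L2_def)
  have "(LINT r|M. (cmod (D r))\<^sup>2) \<le> (LINT r|M. d\<^sup>2)"
    using bound int by (intro integral_mono_AE) auto
  also have "\<dots> = (d * C)\<^sup>2" by (simp add: C_def power_mult_distrib mult.commute)
  finally have "L2_norm M D \<le> d * C"
    unfolding L2_norm_def using \<open>d > 0\<close> \<open>C \<ge> 0\<close> by (intro real_le_lsqrt) auto
  also have "\<dots> < d * (C + 1)" using \<open>d > 0\<close> by simp
  also have "\<dots> = e / 2" using \<open>C \<ge> 0\<close> by (simp add: d_def field_simps)
  finally have less: "L2_norm M D < e / 2" .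
  show ?thesis
  proof (rule that)
    show "(\<lambda>r. \<Sum>k\<le>n. c k * of_real (exp (- r) ^ k)) \<in> L2 M"
      using L2_diff[OF h(3) D] by (simp add: D_def)
    show "L2_norm M (\<lambda>r. f r - (\<Sum>k\<le>n. c k * of_real (exp (- r) ^ k))) < e"
      using L2_add_norm_less[OF L2_diff[OF f h(3)] D h(4) less] by (simp add: D_def)
  qed
qed

section \<open>Density of the reachable states\<close>

text \<open>For r > 0 this is the integral of exp (-s r) over s from b to b + 1; at r = 0 it is 0 by
  the division convention.\<close>

definition exp_weight :: "real \<Rightarrow> real \<Rightarrow> real" where
  "exp_weight b r = exp (- b * r) * (1 - exp (- r)) / r"

lemma exp_weight_pos: "r > 0 \<Longrightarrow> exp_weight b r > 0"
  by (simp add: exp_weight_def)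

lemma exp_weight_le: "r > 0 \<Longrightarrow> exp_weight b r \<le> exp (- b * r)"
  using exp_ge_add_one_self[of "- r"] by (simp add: exp_weight_def divide_le_eq)

text \<open>Shifting the interval of integration by k only contributes the factor exp (-k r), so all
  pieces of the control share a single weight.\<close>

lemma exp_weight_add_nat: "exp_weight (b + real k) r = exp_weight b r * exp (- r) ^ k"
proof -
  have "exp (- (b + real k) * r) = exp (- b * r) * exp (- r) ^ k"
    by (simp add: algebra_simps flip: exp_of_nat_mult exp_add)
  then show ?thesis by (simp add: exp_weight_def)
qed

lemma borel_measurable_exp_weight [measurable]: "exp_weight b \<in> borel_measurable borel"
  unfolding exp_weight_def by measurable

text \<open>With s = 1 / (4 \<xi>) the integral becomes twice that of exp (-s r) over s from a to a
  + 1. In the integrand one factor 1 / (2 \<xi>) belongs to the heat kernel and the remaining 1 /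
  \<xi> to the control.\<close>

lemma has_bochner_integral_heat_kernel:
  assumes "a > 0" "r > 0"
  shows "has_bochner_integral lborel
    (\<lambda>\<xi>. exp (- (r / (4 * \<xi>))) / (2 * \<xi>\<^sup>2) * indicator {1 / (4 * (a + 1))..1 / (4 * a)} \<xi>)
    (2 * exp_weight a r)"
proof -
  define F where "F \<xi> = 2 / r * exp (- (r / (4 * \<xi>)))" for \<xi>
  have "has_bochner_integral lborel
    (\<lambda>\<xi>. exp (- (r / (4 * \<xi>))) / (2 * \<xi>\<^sup>2) * indicator {1 / (4 * (a + 1))..1 / (4 * a)} \<xi>)
    (F (1 / (4 * a)) - F (1 / (4 * (a + 1))))"
  proof (rule has_bochner_integral_FTC_Icc_real)
    show "1 / (4 * (a + 1)) \<le> 1 / (4 * a)" using assms by (simp add: field_simps)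
    fix \<xi> assume "1 / (4 * (a + 1)) \<le> \<xi>"
    moreover have "0 < 1 / (4 * (a + 1))" using assms by simp
    ultimately have "\<xi> > 0" by linarith
    then show "DERIV F \<xi> :> exp (- (r / (4 * \<xi>))) / (2 * \<xi>\<^sup>2)"
      unfolding F_def using \<open>r > 0\<close>
      by (auto intro!: derivative_eq_intros simp: field_simps power2_eq_square)
    show "isCont (\<lambda>\<xi>. exp (- (r / (4 * \<xi>))) / (2 * \<xi>\<^sup>2)) \<xi>"
      using \<open>\<xi> > 0\<close> by (intro continuous_intros) auto
  qed
  also have "F (1 / (4 * a)) - F (1 / (4 * (a + 1))) = 2 * exp_weight a r"
    using assms by (simp add: F_def exp_weight_def field_simps flip: exp_add)
  finally show ?thesis .
qed

text \<open>The piece of the control on \<open>J k\<close> produces the k-th power of exp (-r) times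
  the common weight. The origin is excluded because the integral formula divides by r.\<close>

lemma final_state_exp_polynomial:
  fixes c :: "nat \<Rightarrow> complex"
  assumes "T > 0"
  obtains u where "u \<in> Linf (lebesgue_on {0<..<T})"
    "\<And>x. x \<noteq> 0 \<Longrightarrow> final_state u T x = of_real (exp_weight (1 / T) ((norm x)\<^sup>2)) *
        (\<Sum>k\<le>n. c k * of_real (exp (- (norm x)\<^sup>2) ^ k))"
proof -
  \<comment> \<open>The upper endpoint is at most T / 4, so \<open>J k\<close> lies inside (0, T);
    the lower one is positive, so 1 / \<xi> is bounded on \<open>J k\<close>.\<close>
  define J where "J k = {1 / (4 * (1 / T + real k + 1))..1 / (4 * (1 / T + real k))}" for k
  \<comment> \<open>The factor -pi / 2 cancels the -1 / pi of \<open>final_state\<close> together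
    with the 2 from the kernel integral.\<close>
  define v where "v \<xi> = (\<Sum>k\<le>n. - (pi / 2) * c k * of_real (indicator (J k) \<xi> / \<xi>))" for \<xi>
  have J: "0 < \<xi>" "\<xi> < T" "1 / \<xi> \<le> 4 * (1 / T + real k + 1)" if "\<xi> \<in> J k" for \<xi> k
  proof -
    have lower: "1 / (4 * (1 / T + real k + 1)) \<le> \<xi>" and "\<xi> \<le> 1 / (4 * (1 / T + real k))"
      using that by (auto simp: J_def)
    have pos: "4 * (1 / T + real k + 1) > 0" using \<open>T > 0\<close> by (simp add: add_pos_nonneg)
    then show "0 < \<xi>" using lower by (meson less_le_trans zero_less_divide_1_iff)
    then show "1 / \<xi> \<le> 4 * (1 / T + real k + 1)"
      using lower pos by (simp add: field_simps)
    have "1 / (4 * (1 / T + real k)) \<le> 1 / (4 * (1 / T))"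
      using \<open>T > 0\<close> by (intro divide_left_mono mult_pos_pos add_pos_nonneg) auto
    also have "\<dots> < T" using \<open>T > 0\<close> by simp
    finally show "\<xi> < T" using \<open>\<xi> \<le> 1 / (4 * (1 / T + real k))\<close> by linarith
  qed
  have v_meas [measurable]: "v \<in> borel_measurable borel"
    unfolding v_def J_def by measurable
  have bound: "cmod (v \<xi>) \<le> (\<Sum>k\<le>n. cmod (- (pi / 2) * c k) * (4 * (1 / T + real k + 1)))" for \<xi>
    unfolding v_def
  proof (rule sum_norm_le)
    fix k
    have "\<bar>indicator (J k) \<xi> / \<xi>\<bar> \<le> 4 * (1 / T + real k + 1)"
      using J[of \<xi> k] \<open>T > 0\<close> by (cases "\<xi> \<in> J k") auto
    then show "cmod (- (pi / 2) * c k * of_real (indicator (J k) \<xi> / \<xi>))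
        \<le> cmod (- (pi / 2) * c k) * (4 * (1 / T + real k + 1))"
      unfolding norm_mult norm_of_real by (intro mult_left_mono) auto
  qed
  show ?thesis
  proof (rule that)
    \<comment> \<open>Time reversal: \<open>final_state\<close> evaluates the control at T - \<xi>,
      which gives back \<open>v \<xi>\<close>.\<close>
    show "(\<lambda>t. v (T - t)) \<in> Linf (lebesgue_on {0<..<T})"
      unfolding Linf_def using bound
      by (auto intro!: measurable_restrict_space1 measurable_completion)
    fix x :: "real^2" assume "x \<noteq> 0"
    define r where "r = (norm x)\<^sup>2"
    have "r > 0" using \<open>x \<noteq> 0\<close> by (simp add: r_def)
    define E where "E k \<xi> = exp (- (r / (4 * \<xi>))) / (2 * \<xi>\<^sup>2) * indicator (J k) \<xi>" for k \<xi>
    have E: "has_bochner_integral lborel (E k) (2 * exp_weight (1 / T + real k) r)" for k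
      unfolding E_def J_def using \<open>T > 0\<close> \<open>r > 0\<close>
      by (intro has_bochner_integral_heat_kernel) (auto simp: add_pos_nonneg)
    have [measurable]: "E k \<in> borel_measurable borel" for k
      using E[of k] by (auto dest: borel_measurable_has_bochner_integral)
    have "indicator {0<..<T} \<xi> *\<^sub>R (complex_of_real (1 / (2 * \<xi>) * exp (- (r / (4 * \<xi>)))) * v \<xi>)
        = (\<Sum>k\<le>n. - (pi / 2) * c k * of_real (E k \<xi>))" for \<xi>
      unfolding v_def sum_distrib_left scaleR_sum_right
    proof (rule sum.cong[OF refl])
      fix k
      show "indicator {0<..<T} \<xi> *\<^sub>R (complex_of_real (1 / (2 * \<xi>) * exp (- (r / (4 * \<xi>)))) *
          (- (pi / 2) * c k * of_real (indicator (J k) \<xi> / \<xi>))) = - (pi / 2) * c k * of_real (E k \<xi>)"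
        using J[of \<xi> k] by (cases "\<xi> \<in> J k") (auto simp: E_def power2_eq_square)
    qed
    then have "final_state (\<lambda>t. v (T - t)) T x =
        - (1 / of_real pi) * (LINT \<xi>|lebesgue. (\<Sum>k\<le>n. - (pi / 2) * c k * of_real (E k \<xi>)))"
      by (simp only: final_state_def set_lebesgue_integral_def diff_diff_eq2 diff_add_cancel
          add_diff_cancel_left' r_def)
    also have "(LINT \<xi>|lebesgue. (\<Sum>k\<le>n. - (pi / 2) * c k * of_real (E k \<xi>))) =
        (LINT \<xi>|lborel. (\<Sum>k\<le>n. - (pi / 2) * c k * of_real (E k \<xi>)))"
      by (rule integral_completion) measurable
    also have "(LINT \<xi>|lborel. (\<Sum>k\<le>n. - (pi / 2) * c k * of_real (E k \<xi>))) =
        (\<Sum>k\<le>n. - (pi / 2) * c k * of_real (2 * exp_weight (1 / T + real k) r))"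
      by (intro has_bochner_integral_integral_eq has_bochner_integral_sum has_bochner_integral_mult_right
          has_bochner_integral_of_real E)
    also have "- (1 / of_real pi) * \<dots> = (\<Sum>k\<le>n. c k * of_real (exp_weight (1 / T + real k) r))"
      unfolding sum_distrib_left by (intro sum.cong) (auto simp: field_simps)
    also have "\<dots> = of_real (exp_weight (1 / T) r) * (\<Sum>k\<le>n. c k * of_real (exp (- r) ^ k))"
      unfolding sum_distrib_left
      by (intro sum.cong) (auto simp: exp_weight_add_nat mult_ac)
    finally show "final_state (\<lambda>t. v (T - t)) T x = of_real (exp_weight (1 / T) ((norm x)\<^sup>2)) *
        (\<Sum>k\<le>n. c k * of_real (exp (- (norm x)\<^sup>2) ^ k))"
      by (simp only: r_def)
  qed
qed

section \<open>The weighted space and the lower inclusion\<close>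

lemma L2_density_iff:
  assumes [measurable]: "w \<in> borel_measurable M" "F \<in> borel_measurable M"
  shows "F \<in> L2 (density M (\<lambda>x. ennreal ((w x)\<^sup>2))) \<longleftrightarrow> (\<lambda>x. of_real (w x) * F x) \<in> L2 M"
  by (simp add: L2_def integrable_density norm_mult power_mult_distrib)

text \<open>Together with \<open>L2_density_iff\<close> this makes multiplication by
  \<open>w\<close> an isometry from the weighted space into \<open>L2 M\<close>.\<close>

lemma L2_norm_density:
  assumes [measurable]: "w \<in> borel_measurable M" "F \<in> borel_measurable M"
  shows "L2_norm (density M (\<lambda>x. ennreal ((w x)\<^sup>2))) F = L2_norm M (\<lambda>x. of_real (w x) * F x)"
  by (simp add: L2_norm_def integral_density norm_mult power_mult_distrib)

text \<open>By 1 - exp (-r) \<le> r the squared weight is at most exp (-2 b r) for r > 0, so the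
  total mass is at most pi / (2 b).\<close>

lemma finite_measure_exp_weight:
  assumes "b > 0"
  shows "finite_measure (density radial_measure (\<lambda>r. ennreal ((exp_weight b r)\<^sup>2)))"
proof
  have "emeasure (density radial_measure (\<lambda>r. ennreal ((exp_weight b r)\<^sup>2))) UNIV =
      (\<integral>\<^sup>+ r. ennreal (pi * indicator {0<..} r) * ennreal ((exp_weight b r)\<^sup>2) \<partial>lborel)"
    unfolding radial_measure_def
    by (subst emeasure_density) (auto simp: nn_integral_density)
  also have "\<dots> \<le> (\<integral>\<^sup>+ r. ennreal (pi * exp (- (2 * b) * r)) * indicator {0..} r \<partial>lborel)"
  proof (rule nn_integral_mono)
    fix r :: real
    have "(exp_weight b r)\<^sup>2 \<le> exp (- (2 * b) * r)" if "r > 0"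
    proof -
      have "(exp_weight b r)\<^sup>2 \<le> (exp (- b * r))\<^sup>2"
        using that by (intro power_mono exp_weight_le less_imp_le[OF exp_weight_pos])
      also have "\<dots> = exp (- (2 * b) * r)" by (simp flip: exp_double)
      finally show ?thesis .
    qed
    then show "ennreal (pi * indicator {0<..} r) * ennreal ((exp_weight b r)\<^sup>2)
        \<le> ennreal (pi * exp (- (2 * b) * r)) * indicator {0..} r"
      by (auto simp: indicator_def intro!: ennreal_leI simp flip: ennreal_mult)
  qed
  also have "\<dots> = ennreal (0 - (- (pi / (2 * b)) * exp (- (2 * b) * 0)))"
  proof (rule nn_integral_FTC_atLeast)
    show "DERIV (\<lambda>r. - (pi / (2 * b)) * exp (- (2 * b) * r)) r :> pi * exp (- (2 * b) * r)" for r
      using assms by (auto intro!: derivative_eq_intros)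
    have "((\<lambda>r. exp (- (2 * b) * r)) \<longlongrightarrow> 0) at_top"
      using assms
      by (intro filterlim_compose[OF exp_at_bot] filterlim_tendsto_neg_mult_at_bot[OF tendsto_const _ filterlim_ident])
        auto
    from tendsto_mult_left[OF this, of "- (pi / (2 * b))"]
    show "((\<lambda>r. - (pi / (2 * b)) * exp (- (2 * b) * r)) \<longlongrightarrow> 0) at_top" by simp
  qed auto
  also have "\<dots> < \<infinity>" by simp
  finally show "emeasure (density radial_measure (\<lambda>r. ennreal ((exp_weight b r)\<^sup>2)))
      (space (density radial_measure (\<lambda>r. ennreal ((exp_weight b r)\<^sup>2)))) \<noteq> \<infinity>"
    by simp
qed

text \<open>Dividing the profile by the weight moves the problem to a finite measure, where
  exponential polynomials are dense; multiplying back turns them into reachable states.\<close>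

lemma reachable_dense_radial:
  assumes "T > 0" and f: "f \<in> radial_H" and "e > 0"
  shows "\<exists>g\<in>reachable_from_0 T \<inter> Hhat0. L2_norm lebesgue (\<lambda>x. f x - g x) < e"
proof -
  from f obtain G where f_L2: "f \<in> L2 lebesgue" and G [measurable]: "G \<in> borel_measurable borel"
    and fG: "AE x in lebesgue. f x = G ((norm x)\<^sup>2)"
    unfolding radial_H_iff by blast
  have "(\<lambda>x::real^2. G ((norm x)\<^sup>2)) \<in> L2 lebesgue"
    by (rule L2_cong_AE[OF f_L2 fG]) (auto intro!: measurable_completion)
  then have G_L2: "G \<in> L2 radial_measure" by (simp add: L2_radial_iff)
  define w where "w = exp_weight (1 / T)"
  have w_meas [measurable]: "w \<in> borel_measurable borel" by (simp add: w_def)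
  define M where "M = density radial_measure (\<lambda>r. ennreal ((w r)\<^sup>2))"
  have sets_M [measurable_cong]: "sets M = sets borel" by (simp add: M_def)
  define F where "F r = G r / of_real (w r)" for r
  have F_meas [measurable]: "F \<in> borel_measurable borel" unfolding F_def by measurable
  \<comment> \<open>The weight is positive for r > 0, and \<open>radial_measure\<close> ignores the
    rest of the line.\<close>
  have wF: "AE r in radial_measure. of_real (w r) * F r = G r"
    unfolding AE_radial_measure_iff using exp_weight_pos[of _ "1 / T"]
    by (intro AE_I2) (auto simp: F_def w_def less_imp_neq[symmetric])
  have "(\<lambda>r. of_real (w r) * F r) \<in> L2 radial_measure"
    by (rule L2_cong_AE[OF G_L2]) (use wF in \<open>auto elim: eventually_mono\<close>)
  then have F_L2: "F \<in> L2 M"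
    unfolding M_def by (subst L2_density_iff) auto
  have null: "null_sets lborel \<subseteq> null_sets M"
  proof
    fix N :: "real set" assume N: "N \<in> null_sets lborel"
    then have "AE r in radial_measure. r \<notin> N"
      unfolding AE_radial_measure_iff using AE_not_in[OF N] by eventually_elim simp
    then have "AE r in M. r \<notin> N"
      unfolding M_def by (subst AE_density) auto
    then show "N \<in> null_sets M"
      using N by (subst (asm) AE_iff_null_sets[symmetric]) (auto simp: sets_M)
  qed
  have "AE r in radial_measure. r \<ge> 0"
    by (simp add: AE_radial_measure_iff)
  then have "AE r in M. r \<ge> 0"
    unfolding M_def by (subst AE_density) auto
  moreover have "finite_measure M"
    unfolding M_def w_def using \<open>T > 0\<close> by (intro finite_measure_exp_weight) simp
  ultimately obtain c n
    where P_L2: "(\<lambda>r. \<Sum>k\<le>n. c k * of_real (exp (- r) ^ k)) \<in> L2 M"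
      and less: "L2_norm M (\<lambda>r. F r - (\<Sum>k\<le>n. c k * of_real (exp (- r) ^ k))) < e"
    using L2_approx_exp_polynomial[OF _ sets_M null _ F_L2 \<open>e > 0\<close>] by blast
  define P where "P r = (\<Sum>k\<le>n. c k * complex_of_real (exp (- r) ^ k))" for r
  have P_meas [measurable]: "P \<in> borel_measurable borel" unfolding P_def by measurable
  define H where "H r = of_real (w r) * P r" for r
  have H_meas [measurable]: "H \<in> borel_measurable borel" unfolding H_def by measurable
  have "H \<in> L2 radial_measure"
    using P_L2 unfolding M_def H_def P_def by (subst (asm) L2_density_iff) auto
  then have H_L2: "(\<lambda>x::real^2. H ((norm x)\<^sup>2)) \<in> L2 lebesgue" by (simp add: L2_radial_iff)
  obtain u where u: "u \<in> Linf (lebesgue_on {0<..<T})"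
    and final: "\<And>x. x \<noteq> 0 \<Longrightarrow> final_state u T x = H ((norm x)\<^sup>2)"
    using final_state_exp_polynomial[OF \<open>T > 0\<close>, where n = n and c = c]
    unfolding H_def P_def w_def by blast
  define g where "g = final_state u T"
  \<comment> \<open>The formula for the state may fail only at the origin, a null set.\<close>
  have gH: "AE x in lebesgue. H ((norm x)\<^sup>2) = g x"
    using AE_norm_power2_pos by eventually_elim (auto simp: g_def final)
  have "(\<lambda>x::real^2. H ((norm x)\<^sup>2)) \<in> borel_measurable lebesgue"
    by (intro measurable_completion) auto
  \<comment> \<open>Measurability of the state is inherited from its a.e. formula by
    completeness.\<close>
  then have g_meas: "g \<in> borel_measurable lebesgue"
    by (rule completion.measurable_AE_cong[OF _ _ gH]) auto
  have g_L2: "g \<in> L2 lebesgue"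
    using H_L2 gH g_meas by (rule L2_cong_AE)
  have "g \<in> radial_H"
    unfolding radial_H_iff using g_L2 gH by (intro conjI bexI[OF _ H_meas]) (auto elim: eventually_mono)
  then have "g \<in> reachable_from_0 T \<inter> Hhat0"
    using radial_H_subset_Hhat0 u by (auto simp: reachable_from_0_def g_def)
  moreover have "L2_norm lebesgue (\<lambda>x. f x - g x) < e"
  proof -
    \<comment> \<open>The error is carried over isometrically from the plane to
      \<open>radial_measure\<close> and from there to \<open>M\<close>.\<close>
    have "L2_norm lebesgue (\<lambda>x. f x - g x) =
        L2_norm lebesgue (\<lambda>x::real^2. (\<lambda>r. G r - H r) ((norm x)\<^sup>2))"
    proof (rule L2_norm_cong_AE)
      show "(\<lambda>x. f x - g x) \<in> borel_measurable lebesgue"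
        using f_L2 g_L2 by (auto simp: L2_def)
      show "(\<lambda>x::real^2. (\<lambda>r. G r - H r) ((norm x)\<^sup>2)) \<in> borel_measurable lebesgue"
        by (intro measurable_completion) auto
      show "AE x in lebesgue. f x - g x = (\<lambda>r. G r - H r) ((norm x)\<^sup>2)"
        using fG gH by eventually_elim simp
    qed
    also have "\<dots> = L2_norm radial_measure (\<lambda>r. G r - H r)"
      by (rule L2_norm_radial) measurable
    also have "\<dots> = L2_norm radial_measure (\<lambda>r. of_real (w r) * (F r - P r))"
      using wF by (intro L2_norm_cong_AE) (auto simp: H_def algebra_simps elim: eventually_mono)
    also have "\<dots> = L2_norm M (\<lambda>r. F r - P r)"
      unfolding M_def by (rule L2_norm_density[symmetric]) auto
    also have "\<dots> < e" using less by (simp only: P_def)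
    finally show ?thesis .
  qed
  ultimately show ?thesis by blast
qed

theorem theorem3p13:
  fixes T :: real
  assumes "T > 0"
  shows "subtopology (L2_topology lebesgue) Hhat0 closure_of reachable_from_0 T = radial_H"
proof
  have sub: "Hhat0 \<subseteq> L2 lebesgue" by (auto simp: Hhat0_def)
  show "radial_H \<subseteq> subtopology (L2_topology lebesgue) Hhat0 closure_of reachable_from_0 T"
    using radial_H_subset_Hhat0 reachable_dense_radial[OF assms]
    by (auto simp: in_closure_of_L2_subtopology[OF sub])
qed (rule closure_reachable_subset)

end
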